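(* Let $a>0$. For $\ell_1,\ell_2>0$ with $\ell_1\ell_2=a^2$, let $R_{\ell_1,\ell_2,a}=[0,\ell_1]\times[0,\ell_2]\times[0,a]$ and set $$\mu_\parallel(\ell_1,\ell_2):=\min\left\{\frac{\pi^2}{\ell_1^2},\frac{\pi^2}{\ell_2^2}\right\},\qquad \lambda_\perp(a):=\frac{\pi^2}{a^2}.$$ Among all rectangular cells $R_{\ell_1,\ell_2,a}$ with $\ell_1\ell_2=a^2$ one has $$\mu_\parallel(\ell_1,\ell_2)\le\lambda_\perp(a).$$ Moreover, $$\max_{\ell_1\ell_2=a^2}\mu_\parallel(\ell_1,\ell_2)=\lambda_\perp(a),$$ and the maximum is attained if and only if $\ell_1=\ell_2=a$. Thus $C_a=[0,a]^3$ is the unique plate-scale saturated cell in this rectangular product class.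
   Context: $\mu_\parallel(\ell_1,\ell_2)$ is the first positive eigenvalue of the Neumann Laplacian on $[0,\ell_1]\times[0,\ell_2]$, and $\lambda_\perp(a)$ is the first eigenvalue of the Dirichlet Laplacian on $(0,a)$. A rectangular cell $R_{\ell_1,\ell_2,a}$ with $\ell_1\ell_2=a^2$ is called plate-scale saturated if $\mu_\parallel(\ell_1,\ell_2)=\lambda_\perp(a)$. *)

theory Defs
  imports "HOL-Analysis.Analysis"
begin

definition mu_parallel :: "real \<Rightarrow> real \<Rightarrow> real" where
  "mu_parallel l1 l2 = min (pi\<^sup>2 / l1\<^sup>2) (pi\<^sup>2 / l2\<^sup>2)"

definition lambda_perp :: "real \<Rightarrow> real" where
  "lambda_perp a = pi\<^sup>2 / a\<^sup>2"

definition admissible_sides :: "real \<Rightarrow> (real \<times> real) set" where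
  "admissible_sides a = {(l1, l2). 0 < l1 \<and> 0 < l2 \<and> l1 * l2 = a\<^sup>2}"

definition rect_cell :: "real \<Rightarrow> real \<Rightarrow> real \<Rightarrow> (real \<times> real \<times> real) set" where
  "rect_cell l1 l2 a = {0..l1} \<times> {0..l2} \<times> {0..a}"

definition rect_cells :: "real \<Rightarrow> (real \<times> real \<times> real) set set" where
  "rect_cells a = (\<lambda>(l1, l2). rect_cell l1 l2 a) ` admissible_sides a"

definition plate_scale_saturated :: "(real \<times> real \<times> real) set \<Rightarrow> bool" where
  "plate_scale_saturated C \<longleftrightarrow>
     (\<exists>l1 l2 a. 0 < a \<and> (l1, l2) \<in> admissible_sides a \<and> C = rect_cell l1 l2 a
        \<and> mu_parallel l1 l2 = lambda_perp a)"

text \<open>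
  The closed forms above are the first positive eigenvalue of the Neumann Laplacian on
  \<open>[0,l1] \<times> [0,l2]\<close> and the first eigenvalue of the Dirichlet Laplacian on \<open>(0,a)\<close>; the
  rest of this theory proves this for classical eigenfunctions, twice continuously
  differentiable up to the boundary. Existence of the mixed second derivative is not required
  in two dimensions, so the class of eigenfunctions contains all \<open>C\<^sup>2\<close> ones.
\<close>

definition dirichlet_eigenvalue :: "real \<Rightarrow> real \<Rightarrow> bool" where
  "dirichlet_eigenvalue a \<mu> \<longleftrightarrow>
     (\<exists>u u' u'' :: real \<Rightarrow> real.
        (\<forall>x\<in>{0..a}. (u has_real_derivative u' x) (at x within {0..a})
            \<and> (u' has_real_derivative u'' x) (at x within {0..a})
            \<and> - u'' x = \<mu> * u x)
      \<and> continuous_on {0..a} u'' \<and> u 0 = 0 \<and> u a = 0 \<and> (\<exists>x\<in>{0..a}. u x \<noteq> 0))"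

definition neumann_eigenvalue :: "real \<Rightarrow> real \<Rightarrow> real \<Rightarrow> bool" where
  "neumann_eigenvalue l1 l2 \<mu> \<longleftrightarrow>
     (\<exists>u ux uy uxx uyy :: real \<Rightarrow> real \<Rightarrow> real.
        (\<forall>f\<in>{u, ux, uy, uxx, uyy}. continuous_on ({0..l1} \<times> {0..l2}) (\<lambda>(x, y). f x y))
      \<and> (\<forall>x\<in>{0..l1}. \<forall>y\<in>{0..l2}.
            ((\<lambda>t. u t y) has_real_derivative ux x y) (at x within {0..l1})
          \<and> ((\<lambda>t. u x t) has_real_derivative uy x y) (at y within {0..l2})
          \<and> ((\<lambda>t. ux t y) has_real_derivative uxx x y) (at x within {0..l1})
          \<and> ((\<lambda>t. uy x t) has_real_derivative uyy x y) (at y within {0..l2})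
          \<and> - (uxx x y + uyy x y) = \<mu> * u x y)
      \<and> (\<forall>y\<in>{0..l2}. ux 0 y = 0 \<and> ux l1 y = 0)
      \<and> (\<forall>x\<in>{0..l1}. uy x 0 = 0 \<and> uy x l2 = 0)
      \<and> (\<exists>x\<in>{0..l1}. \<exists>y\<in>{0..l2}. u x y \<noteq> 0))"

lemma const_of_zero_derivative:
  fixes f :: "real \<Rightarrow> real"
  assumes "\<And>x. x \<in> {0..l} \<Longrightarrow> (f has_real_derivative 0) (at x within {0..l})"
    and "x \<in> {0..l}" "y \<in> {0..l}"
  shows "f x = f y"
proof -
  have "\<exists>c. \<forall>x\<in>{0..l}. f x = c"
    by (rule has_field_derivative_zero_constant) (use assms in auto)
  then show ?thesis using assms by metis
qed

lemma ode_nonneg: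
  fixes f f' :: "real \<Rightarrow> real"
  assumes d: "\<And>x. x \<in> {0..l} \<Longrightarrow> (f has_real_derivative f' x) (at x within {0..l})"
    and d': "\<And>x. x \<in> {0..l} \<Longrightarrow> (f' has_real_derivative c * f x) (at x within {0..l})"
    and c: "0 \<le> c" and l: "0 < l"
    and b: "f 0 * f' 0 = 0" "f l * f' l = 0" and x: "x \<in> {0..l}"
  shows "f' x = 0" "c * f x = 0"
proof -
  define h where "h = (\<lambda>x. (f' x)\<^sup>2 + c * (f x)\<^sup>2)"
  have cont: "continuous_on {0..l} f" "continuous_on {0..l} f'"
    by (rule DERIV_continuous_on[OF d] DERIV_continuous_on[OF d']; simp)+
  have "((\<lambda>x. f x * f' x) has_real_derivative h x) (at x within {0..l})"
    if "x \<in> {0..l}" for x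
    unfolding h_def
    by (rule derivative_eq_intros d[OF that] d'[OF that] refl)+
      (simp add: power2_eq_square algebra_simps)
  then have "(h has_integral (f l * f' l - f 0 * f' 0)) {0..l}"
    by (intro fundamental_theorem_of_calculus)
      (use l in \<open>auto simp: has_real_derivative_iff_has_vector_derivative\<close>)
  then have "integral {0..l} h = 0"
    using b by (simp add: integral_unique)
  moreover have "continuous_on {0..l} h"
    unfolding h_def by (intro continuous_intros cont)
  moreover have "0 \<le> h x" for x
    using c by (simp add: h_def)
  ultimately have "h x = 0"
    using integral_eq_0_iff[of 0 l h] l x by blast
  then show "f' x = 0" "c * f x = 0"
    using c by (auto simp: h_def add_nonneg_eq_0_iff)
qed

lemma ode_energy:
  fixes f f' :: "real \<Rightarrow> real"
  assumes d: "\<And>x. x \<in> {0..l} \<Longrightarrow> (f has_real_derivative f' x) (at x within {0..l})"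
    and d': "\<And>x. x \<in> {0..l} \<Longrightarrow> (f' has_real_derivative - (w\<^sup>2 * f x)) (at x within {0..l})"
    and w: "0 < w" and l: "0 < l" and b: "f l = 0" "f' l = 0" and x: "x \<in> {0..l}"
  shows "f x = 0"
proof -
  have "(f' x)\<^sup>2 + w\<^sup>2 * (f x)\<^sup>2 = (f' l)\<^sup>2 + w\<^sup>2 * (f l)\<^sup>2"
  proof (rule const_of_zero_derivative[where l = l and f = "\<lambda>x. (f' x)\<^sup>2 + w\<^sup>2 * (f x)\<^sup>2"])
    fix x assume x: "x \<in> {0..l}"
    show "((\<lambda>x. (f' x)\<^sup>2 + w\<^sup>2 * (f x)\<^sup>2) has_real_derivative 0) (at x within {0..l})"
      by (rule derivative_eq_intros d[OF x] d'[OF x] refl)+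
        (simp add: power2_eq_square algebra_simps)
  qed (use x l in auto)
  then show ?thesis
    using w b by (simp add: add_nonneg_eq_0_iff)
qed

lemma ode_dirichlet:
  fixes f f' :: "real \<Rightarrow> real"
  assumes d: "\<And>x. x \<in> {0..l} \<Longrightarrow> (f has_real_derivative f' x) (at x within {0..l})"
    and d': "\<And>x. x \<in> {0..l} \<Longrightarrow> (f' has_real_derivative - (w\<^sup>2 * f x)) (at x within {0..l})"
    and w: "0 < w" "w < pi / l" and l: "0 < l" and b: "f 0 = 0" "f l = 0" and x: "x \<in> {0..l}"
  shows "f x = 0"
proof -
  have "w * f l * cos (w * l) - f' l * sin (w * l) = w * f 0 * cos (w * 0) - f' 0 * sin (w * 0)"
  proof (rule const_of_zero_derivative[where l = l and f = "\<lambda>x. w * f x * cos (w * x) - f' x * sin (w * x)"])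
    fix x assume x: "x \<in> {0..l}"
    show "((\<lambda>x. w * f x * cos (w * x) - f' x * sin (w * x)) has_real_derivative 0) (at x within {0..l})"
      by (rule derivative_eq_intros d[OF x] d'[OF x] refl)+
        (simp add: power2_eq_square algebra_simps)
  qed (use l in auto)
  moreover have "0 < sin (w * l)"
    using w l by (intro sin_gt_zero) (auto simp: field_simps)
  ultimately have "f' l = 0"
    using b by simp
  from ode_energy[OF d d' w(1) l b(2) this x] show ?thesis .
qed

lemma ode_neumann:
  fixes f f' :: "real \<Rightarrow> real"
  assumes d: "\<And>x. x \<in> {0..l} \<Longrightarrow> (f has_real_derivative f' x) (at x within {0..l})"
    and d': "\<And>x. x \<in> {0..l} \<Longrightarrow> (f' has_real_derivative - (w\<^sup>2 * f x)) (at x within {0..l})"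
    and w: "0 < w" "w < pi / l" and l: "0 < l" and b: "f' 0 = 0" "f' l = 0" and x: "x \<in> {0..l}"
  shows "f x = 0"
proof -
  have "f' l * cos (w * l) + w * f l * sin (w * l) = f' 0 * cos (w * 0) + w * f 0 * sin (w * 0)"
  proof (rule const_of_zero_derivative[where l = l and f = "\<lambda>x. f' x * cos (w * x) + w * f x * sin (w * x)"])
    fix x assume x: "x \<in> {0..l}"
    show "((\<lambda>x. f' x * cos (w * x) + w * f x * sin (w * x)) has_real_derivative 0) (at x within {0..l})"
      by (rule derivative_eq_intros d[OF x] d'[OF x] refl)+
        (simp add: power2_eq_square algebra_simps)
  qed (use l in auto)
  moreover have "0 < sin (w * l)"
    using w l by (intro sin_gt_zero) (auto simp: field_simps)
  ultimately have "f l = 0"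
    using b w by simp
  from ode_energy[OF d d' w(1) l this b(2) x] show ?thesis .
qed

lemma sqrt_less_pi_div:
  assumes "0 < l" "0 < c" "c < pi\<^sup>2 / l\<^sup>2"
  shows "0 < sqrt c" "sqrt c < pi / l" "(sqrt c)\<^sup>2 = c"
proof -
  have "sqrt c < sqrt ((pi / l)\<^sup>2)"
    using assms by (simp only: real_sqrt_less_iff power_divide)
  then show "sqrt c < pi / l" using assms by simp
qed (use assms in auto)

lemma lambda_perp_first_dirichlet_eigenvalue:
  assumes a: "0 < a"
  shows "dirichlet_eigenvalue a (lambda_perp a)"
    and "dirichlet_eigenvalue a \<nu> \<Longrightarrow> lambda_perp a \<le> \<nu>"
proof -
  define k where "k = pi / a"
  have k: "k * a = pi" "k\<^sup>2 = lambda_perp a"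
    using a by (auto simp: k_def lambda_perp_def power_divide)
  have "((\<lambda>x. sin (k * x)) has_real_derivative k * cos (k * x)) (at x within A)"
    "((\<lambda>x. k * cos (k * x)) has_real_derivative - (k\<^sup>2 * sin (k * x))) (at x within A)" for x A
    by (rule derivative_eq_intros refl | simp add: power2_eq_square)+
  moreover have "sin (k * (a / 2)) \<noteq> 0" "a / 2 \<in> {0..a}"
    using k a by auto
  then have "\<exists>x\<in>{0..a}. sin (k * x) \<noteq> 0" by blast
  moreover have "continuous_on {0..a} (\<lambda>x. - (k\<^sup>2 * sin (k * x)))"
    by (intro continuous_intros)
  ultimately show "dirichlet_eigenvalue a (lambda_perp a)"
    unfolding dirichlet_eigenvalue_def
    by (intro exI[of _ "\<lambda>x. sin (k * x)"] exI[of _ "\<lambda>x. k * cos (k * x)"]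
        exI[of _ "\<lambda>x. - (k\<^sup>2 * sin (k * x))"]) (auto simp: k)
  assume "dirichlet_eigenvalue a \<nu>"
  then obtain u u' u'' where
    d: "\<And>x. x \<in> {0..a} \<Longrightarrow> (u has_real_derivative u' x) (at x within {0..a})"
    and d': "\<And>x. x \<in> {0..a} \<Longrightarrow> (u' has_real_derivative u'' x) (at x within {0..a})"
    and e: "\<And>x. x \<in> {0..a} \<Longrightarrow> - u'' x = \<nu> * u x"
    and b: "u 0 = 0" "u a = 0" and n: "\<exists>x\<in>{0..a}. u x \<noteq> 0"
    unfolding dirichlet_eigenvalue_def by blast
  have e': "u'' x = - \<nu> * u x" if "x \<in> {0..a}" for x
    using e[OF that] by simp
  show "lambda_perp a \<le> \<nu>"
  proof (rule ccontr)
    assume "\<not> ?thesis"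
    then have less: "\<nu> < pi\<^sup>2 / a\<^sup>2" by (simp add: lambda_perp_def)
    have "u x = 0" if x: "x \<in> {0..a}" for x
    proof (cases "0 < \<nu>")
      case True
      note w = sqrt_less_pi_div[OF a True less]
      show ?thesis
        by (rule ode_dirichlet[OF d _ w(1,2) a b x]) (use d' e' w(3) in auto)
    next
      case False
      have "u' x = 0" if "x \<in> {0..a}" for x
        by (rule ode_nonneg(1)[of a u u' "- \<nu>"]) (use d d' e' False a b that in auto)
      with d have "(u has_real_derivative 0) (at x within {0..a})" if "x \<in> {0..a}" for x
        using that by metis
      then have "u x = u 0"
        by (rule const_of_zero_derivative[where f = u and l = a]) (use x a in auto)
      then show ?thesis using b by simp
    qed
    with n show False by blast
  qed
qed

lemma cosines_complete:
  fixes h :: "real \<Rightarrow> real"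
  assumes l: "0 < l" and h: "continuous_on {0..l} h"
    and orth: "\<And>m::nat. integral {0..l} (\<lambda>x. h x * cos (m * pi / l * x)) = 0"
    and x: "x \<in> {0..l}"
  shows "h x = 0"
proof -
  define C where "C = (\<lambda>x. cos (pi / l * x))"
  have Cc: "continuous_on A C" for A
    unfolding C_def by (intro continuous_intros)
  have orth': "integral {0..l} (\<lambda>x. h x * cos (of_int m * pi / l * x)) = 0" for m :: int
  proof -
    have "cos (of_int m * pi / l * x) = cos (real (nat \<bar>m\<bar>) * pi / l * x)" for x
    proof (cases "0 \<le> m")
      case False
      then have "real (nat \<bar>m\<bar>) * pi / l * x = - (of_int m * pi / l * x)" by simp
      then show ?thesis by (simp only: cos_minus)
    qed simp
    then show ?thesis using orth[of "nat \<bar>m\<bar>"] by (simp only:)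
  qed
  have pow: "integral {0..l} (\<lambda>x. h x * (C x ^ i * cos (of_int m * pi / l * x))) = 0" for i and m :: int
  proof (induction i arbitrary: m)
    case 0
    then show ?case using orth' by simp
  next
    case (Suc i)
    have prodsum: "cos (pi / l * x) * cos (of_int m * pi / l * x)
        = (cos (of_int (m + 1) * pi / l * x) + cos (of_int (m - 1) * pi / l * x)) / 2" for x
    proof -
      have "of_int (m + 1) * pi / l * x = of_int m * pi / l * x + pi / l * x"
        "of_int (m - 1) * pi / l * x = of_int m * pi / l * x - pi / l * x"
        by (auto simp: algebra_simps add_divide_distrib diff_divide_distrib)
      then show ?thesis by (simp add: cos_add cos_diff)
    qed
    have eq: "h x * (C x ^ Suc i * cos (of_int m * pi / l * x))
        = (h x * (C x ^ i * cos (of_int (m + 1) * pi / l * x))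
          + h x * (C x ^ i * cos (of_int (m - 1) * pi / l * x))) / 2" for x
    proof -
      have "h x * (C x ^ Suc i * cos (of_int m * pi / l * x))
          = h x * C x ^ i * (cos (pi / l * x) * cos (of_int m * pi / l * x))"
        by (simp add: C_def mult_ac)
      then show ?thesis unfolding prodsum by (simp only: distrib_left times_divide_eq_right mult.assoc)
    qed
    have int: "(\<lambda>x. h x * (C x ^ i * cos (of_int m * pi / l * x))) integrable_on {0..l}" for m :: int
      by (intro integrable_continuous_interval continuous_intros h Cc)
    show ?case
      unfolding eq by (subst integral_divide, subst integral_add[OF int int]) (simp only: Suc, simp)
  qed
  have poly: "integral {0..l} (\<lambda>x. h x * p (C x)) = 0" if p: "real_polynomial_function p" for p
  proof -
    obtain c n where p: "p = (\<lambda>x. \<Sum>i\<le>n. c i * x ^ i)"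
      using p real_polynomial_function_iff_sum by blast
    have i0: "integral {0..l} (\<lambda>x. c i * (h x * C x ^ i)) = 0" for i
      using pow[of i 0] by simp
    have "integral {0..l} (\<lambda>x. h x * p (C x)) = integral {0..l} (\<lambda>x. \<Sum>i\<le>n. c i * (h x * C x ^ i))"
      by (simp add: p sum_distrib_left algebra_simps)
    also have "\<dots> = (\<Sum>i\<le>n. integral {0..l} (\<lambda>x. c i * (h x * C x ^ i)))"
      by (intro integral_sum integrable_continuous_interval continuous_intros h Cc) auto
    finally show ?thesis by (simp only: i0 sum.neutral_const)
  qed
  have ih: "(\<lambda>x. h x * h x) integrable_on {0..l}" "(\<lambda>x. \<bar>h x\<bar>) integrable_on {0..l}"
    by (intro integrable_continuous_interval continuous_intros h)+
  define A where "A = integral {0..l} (\<lambda>x. \<bar>h x\<bar>)"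
  have bound: "integral {0..l} (\<lambda>x. h x * h x) \<le> e * A" if e: "0 < e" for e
  proof -
    have "continuous_on {-1..1} (\<lambda>s. h (l / pi * arccos s))"
    proof (rule continuous_on_compose2[OF h])
      show "continuous_on {-1..1} (\<lambda>s. l / pi * arccos s)"
        by (intro continuous_intros) auto
      have "l / pi * arccos s \<in> {0..l}" if "s \<in> {-1..1}" for s
        using that l arccos_bounded[of s] by (auto simp: field_simps)
      then show "(\<lambda>s. l / pi * arccos s) ` {-1..1} \<subseteq> {0..l}" by auto
    qed
    then obtain p where p: "real_polynomial_function p"
      "\<And>s. s \<in> {-1..1} \<Longrightarrow> \<bar>h (l / pi * arccos s) - p s\<bar> < e"
      using Stone_Weierstrass_real_polynomial_function[OF compact_Icc _ e] by metis
    have close: "\<bar>h x - p (C x)\<bar> \<le> e" if "x \<in> {0..l}" for x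
    proof -
      have "arccos (C x) = pi / l * x"
        unfolding C_def using that l by (intro arccos_cos) (auto simp: field_simps)
      then show ?thesis using p(2)[of "C x"] l by (simp add: C_def)
    qed
    have ip: "(\<lambda>x. h x * p (C x)) integrable_on {0..l}"
    proof -
      obtain c n where "p = (\<lambda>x. \<Sum>i\<le>n. c i * x ^ i)"
        using p(1) real_polynomial_function_iff_sum by blast
      then show ?thesis
        by (auto intro!: integrable_continuous_interval continuous_intros h Cc)
    qed
    have "integral {0..l} (\<lambda>x. h x * h x) = integral {0..l} (\<lambda>x. h x * h x - h x * p (C x))"
      by (subst integral_diff[OF ih(1) ip]) (simp add: poly[OF p(1)])
    also have "\<dots> \<le> integral {0..l} (\<lambda>x. e * \<bar>h x\<bar>)"
    proof (rule integral_le)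
      fix x assume "x \<in> {0..l}"
      have "h x * h x - h x * p (C x) = h x * (h x - p (C x))" by (simp add: algebra_simps)
      also have "\<dots> \<le> \<bar>h x\<bar> * \<bar>h x - p (C x)\<bar>" by (metis abs_ge_self abs_mult)
      also have "\<dots> \<le> \<bar>h x\<bar> * e" by (intro mult_left_mono close) (use \<open>x \<in> _\<close> in auto)
      finally show "h x * h x - h x * p (C x) \<le> e * \<bar>h x\<bar>" by (simp add: mult.commute)
    qed (intro integrable_diff ih ip integrable_on_mult_right)+
    finally show ?thesis by (simp add: A_def)
  qed
  have "0 \<le> A" unfolding A_def by (intro integral_nonneg ih) auto
  have "integral {0..l} (\<lambda>x. h x * h x) \<le> 0"
  proof (rule field_le_epsilon)
    fix e :: real assume e: "0 < e"
    have "integral {0..l} (\<lambda>x. h x * h x) \<le> e / (A + 1) * A"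
      using e \<open>0 \<le> A\<close> by (intro bound) auto
    also have "\<dots> \<le> e" using e \<open>0 \<le> A\<close> by (simp add: field_simps)
    finally show "integral {0..l} (\<lambda>x. h x * h x) \<le> 0 + e" by simp
  qed
  moreover have "0 \<le> integral {0..l} (\<lambda>x. h x * h x)"
    by (intro integral_nonneg ih) auto
  moreover have "continuous_on {0..l} (\<lambda>x. h x * h x)" by (intro continuous_intros h)
  ultimately have "h x * h x = 0"
    using integral_eq_0_iff[of 0 l "\<lambda>x. h x * h x"] l x by auto
  then show ?thesis by simp
qed

lemma neumann_eigenvalue_swap:
  assumes "neumann_eigenvalue l1 l2 \<mu>"
  shows "neumann_eigenvalue l2 l1 \<mu>"
proof -
  have sw: "continuous_on ({0..l2} \<times> {0..l1}) (\<lambda>(x, y). f y x)"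
    if "continuous_on ({0..l1} \<times> {0..l2}) (\<lambda>(x, y). f x y)" for f :: "real \<Rightarrow> real \<Rightarrow> real"
    using continuous_on_compose2[OF that, of "{0..l2} \<times> {0..l1}" "\<lambda>p. (snd p, fst p)"]
    by (force simp: case_prod_unfold intro!: continuous_intros)
  obtain u ux uy uxx uyy where
    c: "\<forall>f\<in>{u, ux, uy, uxx, uyy}. continuous_on ({0..l1} \<times> {0..l2}) (\<lambda>(x, y). f x y)"
    and d: "\<forall>x\<in>{0..l1}. \<forall>y\<in>{0..l2}.
            ((\<lambda>t. u t y) has_real_derivative ux x y) (at x within {0..l1})
          \<and> ((\<lambda>t. u x t) has_real_derivative uy x y) (at y within {0..l2})
          \<and> ((\<lambda>t. ux t y) has_real_derivative uxx x y) (at x within {0..l1})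
          \<and> ((\<lambda>t. uy x t) has_real_derivative uyy x y) (at y within {0..l2})
          \<and> - (uxx x y + uyy x y) = \<mu> * u x y"
    and b: "\<forall>y\<in>{0..l2}. ux 0 y = 0 \<and> ux l1 y = 0" "\<forall>x\<in>{0..l1}. uy x 0 = 0 \<and> uy x l2 = 0"
    and n: "\<exists>x\<in>{0..l1}. \<exists>y\<in>{0..l2}. u x y \<noteq> 0"
    using assms unfolding neumann_eigenvalue_def by blast
  have c': "\<forall>f\<in>{\<lambda>x y. u y x, \<lambda>x y. uy y x, \<lambda>x y. ux y x, \<lambda>x y. uyy y x, \<lambda>x y. uxx y x}.
      continuous_on ({0..l2} \<times> {0..l1}) (\<lambda>(x, y). f x y)"
    using c by (simp add: sw)
  show ?thesis
    unfolding neumann_eigenvalue_def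
    by (rule exI[of _ "\<lambda>x y. u y x"], rule exI[of _ "\<lambda>x y. uy y x"], rule exI[of _ "\<lambda>x y. ux y x"],
        rule exI[of _ "\<lambda>x y. uyy y x"], rule exI[of _ "\<lambda>x y. uxx y x"], intro conjI c')
      (use d b n in \<open>auto simp: add.commute\<close>)
qed

lemma neumann_eigenvalue_cos:
  assumes l: "0 < l1" "0 < l2"
  shows "neumann_eigenvalue l1 l2 (pi\<^sup>2 / l1\<^sup>2)"
proof -
  define k where "k = pi / l1"
  have k: "k * l1 = pi" "k\<^sup>2 = pi\<^sup>2 / l1\<^sup>2"
    using l by (auto simp: k_def power_divide)
  have dc: "((\<lambda>t. cos (k * t)) has_real_derivative - (k * sin (k * x))) (at x within A)"
    "((\<lambda>t. - (k * sin (k * t))) has_real_derivative - (k\<^sup>2 * cos (k * x))) (at x within A)" for x A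
    by (rule derivative_eq_intros refl | simp add: power2_eq_square)+
  have nz: "\<exists>x\<in>{0..l1}. \<exists>y\<in>{0..l2}. cos (k * x) \<noteq> 0"
    using l by (intro bexI[of _ 0]) auto
  have co: "\<forall>f\<in>{\<lambda>x y. cos (k * x), \<lambda>x y. - (k * sin (k * x)), \<lambda>x y. 0,
      \<lambda>x y. - (k\<^sup>2 * cos (k * x)), \<lambda>x y. 0}. continuous_on ({0..l1} \<times> {0..l2}) (\<lambda>(x, y). f x y)"
    unfolding case_prod_unfold ball_simps by (intro conjI continuous_intros TrueI)
  show ?thesis
    unfolding neumann_eigenvalue_def
    by (rule exI[of _ "\<lambda>x y. cos (k * x)"], rule exI[of _ "\<lambda>x y. - (k * sin (k * x))"],
        rule exI[of _ "\<lambda>x y. 0"], rule exI[of _ "\<lambda>x y. - (k\<^sup>2 * cos (k * x))"],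
        rule exI[of _ "\<lambda>x y. 0"], intro conjI co nz) (use dc in \<open>auto simp: k\<close>)
qed

lemma mu_parallel_first_positive_neumann_eigenvalue:
  assumes l: "0 < l1" "0 < l2"
  shows "neumann_eigenvalue l1 l2 (mu_parallel l1 l2)" and "0 < mu_parallel l1 l2"
    and "neumann_eigenvalue l1 l2 \<nu> \<Longrightarrow> 0 < \<nu> \<Longrightarrow> mu_parallel l1 l2 \<le> \<nu>"
proof -
  show "neumann_eigenvalue l1 l2 (mu_parallel l1 l2)"
    using neumann_eigenvalue_cos[OF l] neumann_eigenvalue_swap[OF neumann_eigenvalue_cos[OF l(2,1)]]
    by (simp add: mu_parallel_def min_def)
  show "0 < mu_parallel l1 l2"
    using l by (simp add: mu_parallel_def)
  assume "neumann_eigenvalue l1 l2 \<nu>" and pos: "0 < \<nu>"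
  then obtain u ux uy uxx uyy where
    cont: "\<forall>f\<in>{u, ux, uy, uxx, uyy}. continuous_on ({0..l1} \<times> {0..l2}) (\<lambda>(x, y). f x y)"
    and d: "\<And>x y. x \<in> {0..l1} \<Longrightarrow> y \<in> {0..l2} \<Longrightarrow>
            ((\<lambda>t. u t y) has_real_derivative ux x y) (at x within {0..l1})
          \<and> ((\<lambda>t. u x t) has_real_derivative uy x y) (at y within {0..l2})
          \<and> ((\<lambda>t. ux t y) has_real_derivative uxx x y) (at x within {0..l1})
          \<and> ((\<lambda>t. uy x t) has_real_derivative uyy x y) (at y within {0..l2})
          \<and> - (uxx x y + uyy x y) = \<nu> * u x y"
    and bx: "\<forall>y\<in>{0..l2}. ux 0 y = 0 \<and> ux l1 y = 0"
    and byy: "\<forall>x\<in>{0..l1}. uy x 0 = 0 \<and> uy x l2 = 0"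
    and n: "\<exists>x\<in>{0..l1}. \<exists>y\<in>{0..l2}. u x y \<noteq> 0"
    unfolding neumann_eigenvalue_def by blast
  have slice: "continuous_on {0..l1} (\<lambda>x. f x y)"
    if "f \<in> {u, ux, uy, uxx, uyy}" "y \<in> {0..l2}" for f y
    using continuous_on_compose2[OF cont[rule_format, OF that(1)], of "{0..l1}" "\<lambda>x. (x, y)"] that(2)
    by (force intro!: continuous_intros)
  have flip: "continuous_on ({0..l2} \<times> {0..l1}) (\<lambda>(y, x). f x y * cos (k * x))"
    if "f \<in> {u, ux, uy, uxx, uyy}" for f and k :: real
  proof -
    have "continuous_on ({0..l2} \<times> {0..l1}) (\<lambda>p. f (snd p) (fst p))"
      using continuous_on_compose2[OF cont[rule_format, OF that], of "{0..l2} \<times> {0..l1}" "\<lambda>p. (snd p, fst p)"]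
      by (force simp: case_prod_unfold intro!: continuous_intros)
    then show ?thesis
      by (auto simp: case_prod_unfold intro!: continuous_intros)
  qed
  show "mu_parallel l1 l2 \<le> \<nu>"
  proof (rule ccontr)
    assume "\<not> ?thesis"
    then have less: "\<nu> < pi\<^sup>2 / l1\<^sup>2" "\<nu> < pi\<^sup>2 / l2\<^sup>2"
      by (auto simp: mu_parallel_def)
    have "u x y = 0" if x: "x \<in> {0..l1}" and y: "y \<in> {0..l2}" for x y
    proof (rule cosines_complete[OF l(1) _ _ x])
      show "continuous_on {0..l1} (\<lambda>x. u x y)" using slice y by auto
      fix m :: nat
      define k where "k = m * pi / l1"
      have k: "sin (k * l1) = 0" using l by (simp add: k_def)
      define g where "g = (\<lambda>y. integral {0..l1} (\<lambda>x. u x y * cos (k * x)))"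
      define g' where "g' = (\<lambda>y. integral {0..l1} (\<lambda>x. uy x y * cos (k * x)))"
      have int: "(\<lambda>x. f x y * cos (k * x)) integrable_on {0..l1}"
        if "f \<in> {u, ux, uy, uxx, uyy}" "y \<in> {0..l2}" for f y
        by (intro integrable_continuous_interval continuous_intros slice that)
      have dg: "(g has_real_derivative g' y) (at y within {0..l2})" if "y \<in> {0..l2}" for y
        unfolding g_def g'_def
        by (rule leibniz_rule_field_derivative[where a = 0 and b = l1, unfolded cbox_interval])
          (use d int flip that in \<open>auto intro!: DERIV_cmult_right\<close>)
      have dg': "(g' has_real_derivative (k\<^sup>2 - \<nu>) * g y) (at y within {0..l2})"
        if y: "y \<in> {0..l2}" for y
      proof -
        have "((\<lambda>x. ux x y * cos (k * x) + k * u x y * sin (k * x)) has_real_derivative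
            uxx x y * cos (k * x) + k\<^sup>2 * (u x y * cos (k * x))) (at x within {0..l1})"
          if x: "x \<in> {0..l1}" for x
        proof -
          have "((\<lambda>t. u t y) has_real_derivative ux x y) (at x within {0..l1})"
            "((\<lambda>t. ux t y) has_real_derivative uxx x y) (at x within {0..l1})"
            using d[OF x y] by auto
          note [derivative_intros] = this
          show ?thesis
            by (rule derivative_eq_intros refl)+ (simp add: power2_eq_square algebra_simps)
        qed
        then have "((\<lambda>x. uxx x y * cos (k * x) + k\<^sup>2 * (u x y * cos (k * x))) has_integral
            (ux l1 y * cos (k * l1) + k * u l1 y * sin (k * l1)
              - (ux 0 y * cos (k * 0) + k * u 0 y * sin (k * 0)))) {0..l1}"
          by (intro fundamental_theorem_of_calculus)
            (use l in \<open>auto simp: has_real_derivative_iff_has_vector_derivative\<close>)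
        then have "integral {0..l1} (\<lambda>x. uxx x y * cos (k * x) + k\<^sup>2 * (u x y * cos (k * x))) = 0"
          using bx y k by (simp add: integral_unique)
        then have parts: "integral {0..l1} (\<lambda>x. uxx x y * cos (k * x)) = - (k\<^sup>2 * g y)"
          by (subst (asm) integral_add) (use int y in \<open>auto simp: g_def intro!: integrable_on_mult_right\<close>)
        have "integral {0..l1} (\<lambda>x. uyy x y * cos (k * x))
            = integral {0..l1} (\<lambda>x. - \<nu> * (u x y * cos (k * x)) - uxx x y * cos (k * x))"
        proof (rule integral_cong)
          fix x assume "x \<in> {0..l1}"
          then have "uyy x y = - \<nu> * u x y - uxx x y" using d[of x y] y by auto
          show "uyy x y * cos (k * x) = - \<nu> * (u x y * cos (k * x)) - uxx x y * cos (k * x)"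
            unfolding \<open>uyy x y = _\<close> by (simp add: algebra_simps)
        qed
        also have "\<dots> = integral {0..l1} (\<lambda>x. - \<nu> * (u x y * cos (k * x)))
            - integral {0..l1} (\<lambda>x. uxx x y * cos (k * x))"
          by (intro integral_diff integrable_on_mult_right int) (use y in auto)
        also have "\<dots> = - \<nu> * g y - - (k\<^sup>2 * g y)"
          unfolding parts by (simp only: integral_mult_right g_def)
        finally have eq: "integral {0..l1} (\<lambda>x. uyy x y * cos (k * x)) = (k\<^sup>2 - \<nu>) * g y"
          by (simp add: algebra_simps)
        show ?thesis
          unfolding g'_def eq[symmetric]
          by (rule leibniz_rule_field_derivative[where a = 0 and b = l1, unfolded cbox_interval])
            (use d int flip y in \<open>auto intro!: DERIV_cmult_right\<close>)
      qed
      have "g' y = 0" if "\<And>x. x \<in> {0..l1} \<Longrightarrow> uy x y = 0" for y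
      proof -
        have "g' y = integral {0..l1} (\<lambda>x. 0)"
          unfolding g'_def by (rule integral_cong) (simp add: that)
        then show ?thesis by simp
      qed
      then have b: "g' 0 = 0" "g' l2 = 0"
        using byy by auto
      have "g y = 0"
      proof (cases "m = 0")
        case True
        note w = sqrt_less_pi_div[OF l(2) pos less(2)]
        show ?thesis
          by (rule ode_neumann[OF dg _ w(1,2) l(2) b y]) (use dg' w(3) True in \<open>auto simp: k_def\<close>)
      next
        case False
        have "1 * (pi\<^sup>2 / l1\<^sup>2) \<le> (real m)\<^sup>2 * (pi\<^sup>2 / l1\<^sup>2)"
          using False by (intro mult_right_mono) auto
        then have "\<nu> < k\<^sup>2"
          using less(1) by (simp add: k_def power_divide power_mult_distrib)
        then show ?thesis
          using ode_nonneg(2)[of l2 g g' "k\<^sup>2 - \<nu>" y] dg dg' l b y by auto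
      qed
      then show "integral {0..l1} (\<lambda>x. u x y * cos (m * pi / l1 * x)) = 0"
        by (simp add: g_def k_def)
    qed
    with n show False by blast
  qed
qed

end

theory Submission
  imports Defs
begin

text \<open>
  The first positive Neumann eigenvalue of a rectangle depends on its longer side only:
  \<open>mu_parallel l1 l2 = pi\<^sup>2 / (max l1 l2)\<^sup>2\<close>. Under the constraint \<open>l1 * l2 = a\<^sup>2\<close> the number \<open>a\<close> is
  the geometric mean of the sides, so the longer side is at least \<open>a\<close>, and it equals \<open>a\<close> only for
  the square. As \<open>pi\<^sup>2 / t\<^sup>2\<close> is strictly decreasing in \<open>t > 0\<close>, this gives the bound by
  \<open>lambda_perp a\<close> (lemma \<open>mu_parallel_le_lambda_perp\<close>) together with its equality case
  (lemma \<open>mu_parallel_eq_lambda_perp_iff\<close>), and the square attains the bound.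

  Saturation is a property of the cell as a point set and quantifies over all ways to write that
  set as a box. A nonempty box determines its sides, so this freedom is harmless: the saturated
  cells are exactly the cubes, and the cells of height \<open>a\<close> contain one cube.
\<close>

lemma mu_parallel_eq_longer_side:
  assumes "0 < l1" "0 < l2"
  shows "mu_parallel l1 l2 = pi\<^sup>2 / (max l1 l2)\<^sup>2"
proof (cases "l1 \<le> l2")
  case True
  then have "pi\<^sup>2 / l2\<^sup>2 \<le> pi\<^sup>2 / l1\<^sup>2"
    using assms by (intro divide_left_mono power_mono) auto
  with True show ?thesis by (simp add: mu_parallel_def max_def)
next
  case False
  then have "pi\<^sup>2 / l1\<^sup>2 \<le> pi\<^sup>2 / l2\<^sup>2"
    using assms by (intro divide_left_mono power_mono) auto
  with False show ?thesis by (simp add: mu_parallel_def max_def)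
qed

lemma geometric_mean_le_max:
  fixes l1 l2 a :: real
  assumes "0 < l1" "0 < l2" "l1 * l2 = a\<^sup>2"
  shows "a \<le> max l1 l2"
proof (rule power2_le_imp_le)
  have "l1 * l2 \<le> max l1 l2 * max l1 l2"
    using assms by (intro mult_mono) auto
  then show "a\<^sup>2 \<le> (max l1 l2)\<^sup>2"
    using assms by (simp add: power2_eq_square)
qed (use assms in auto)

lemma geometric_mean_eq_max_iff:
  fixes l1 l2 a :: real
  assumes "0 < l1" "0 < l2" "l1 * l2 = a\<^sup>2"
  shows "max l1 l2 = a \<longleftrightarrow> l1 = a \<and> l2 = a"
  using assms by (auto simp: max_def power2_eq_square)

lemma mu_parallel_le_lambda_perp:
  assumes "0 < a" "(l1, l2) \<in> admissible_sides a"
  shows "mu_parallel l1 l2 \<le> lambda_perp a"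
proof -
  have l: "0 < l1" "0 < l2" "l1 * l2 = a\<^sup>2"
    using assms(2) by (auto simp: admissible_sides_def)
  have "pi\<^sup>2 / (max l1 l2)\<^sup>2 \<le> pi\<^sup>2 / a\<^sup>2"
    using assms(1) l geometric_mean_le_max[OF l]
    by (intro divide_left_mono power_mono mult_pos_pos zero_less_power) auto
  then show ?thesis
    by (simp only: mu_parallel_eq_longer_side[OF l(1,2)] lambda_perp_def)
qed

lemma mu_parallel_eq_lambda_perp_iff:
  assumes "0 < a" "(l1, l2) \<in> admissible_sides a"
  shows "mu_parallel l1 l2 = lambda_perp a \<longleftrightarrow> l1 = a \<and> l2 = a"
proof -
  have l: "0 < l1" "0 < l2" "l1 * l2 = a\<^sup>2"
    using assms(2) by (auto simp: admissible_sides_def)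
  have "mu_parallel l1 l2 = lambda_perp a \<longleftrightarrow> (max l1 l2)\<^sup>2 = a\<^sup>2"
    unfolding mu_parallel_eq_longer_side[OF l(1,2)] lambda_perp_def by simp
  also have "\<dots> \<longleftrightarrow> max l1 l2 = a"
    using assms(1) l by (intro power2_eq_iff_nonneg) auto
  finally show ?thesis
    by (simp only: geometric_mean_eq_max_iff[OF l])
qed

lemma square_admissible: "0 < a \<Longrightarrow> (a, a) \<in> admissible_sides a"
  by (simp add: admissible_sides_def power2_eq_square)

lemma is_arg_max_mu_parallel_iff:
  assumes "0 < a"
  shows "is_arg_max (\<lambda>(l1, l2). mu_parallel l1 l2) (\<lambda>p. p \<in> admissible_sides a) (l1, l2)
    \<longleftrightarrow> l1 = a \<and> l2 = a"
proof
  assume max: "is_arg_max (\<lambda>(l1, l2). mu_parallel l1 l2) (\<lambda>p. p \<in> admissible_sides a) (l1, l2)"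
  then have adm: "(l1, l2) \<in> admissible_sides a"
    by (simp add: is_arg_max_def)
  have "mu_parallel a a \<le> mu_parallel l1 l2"
    using max square_admissible[OF assms] by (force simp: is_arg_max_linorder)
  moreover have "mu_parallel a a = lambda_perp a"
    using mu_parallel_eq_lambda_perp_iff[OF assms square_admissible[OF assms]] by simp
  ultimately have "mu_parallel l1 l2 = lambda_perp a"
    using mu_parallel_le_lambda_perp[OF assms adm] by simp
  then show "l1 = a \<and> l2 = a"
    using mu_parallel_eq_lambda_perp_iff[OF assms adm] by simp
next
  assume "l1 = a \<and> l2 = a"
  then show "is_arg_max (\<lambda>(l1, l2). mu_parallel l1 l2) (\<lambda>p. p \<in> admissible_sides a) (l1, l2)"
    using mu_parallel_le_lambda_perp[OF assms] square_admissible[OF assms]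
      mu_parallel_eq_lambda_perp_iff[OF assms square_admissible[OF assms]]
    by (auto simp: is_arg_max_linorder)
qed

text \<open>
  The side lengths can be read off from the point set, by projecting to the coordinate axes. This
  rules out that a cell is saturated by virtue of a representation with another height.
\<close>

lemma rect_cell_eq_iff:
  assumes "0 < l1" "0 < l2" "0 < a"
  shows "rect_cell l1 l2 a = rect_cell k1 k2 b \<longleftrightarrow> l1 = k1 \<and> l2 = k2 \<and> a = b"
  using assms by (auto simp: rect_cell_def times_eq_iff Icc_eq_Icc)

lemma plate_scale_saturated_iff_cube:
  "plate_scale_saturated C \<longleftrightarrow> (\<exists>b>0. C = rect_cell b b b)"
  unfolding plate_scale_saturated_def
  using mu_parallel_eq_lambda_perp_iff square_admissible by blast

lemma saturated_rect_cells:
  assumes "0 < a"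
  shows "{C \<in> rect_cells a. plate_scale_saturated C} = {rect_cell a a a}"
proof (intro equalityI subsetI)
  fix C assume "C \<in> {C \<in> rect_cells a. plate_scale_saturated C}"
  then obtain l1 l2 b where "C = rect_cell l1 l2 a" "0 < b" "C = rect_cell b b b"
    by (auto simp: rect_cells_def plate_scale_saturated_iff_cube)
  then show "C \<in> {rect_cell a a a}"
    using rect_cell_eq_iff[of b b b l1 l2 a] by auto
next
  fix C assume "C \<in> {rect_cell a a a}"
  then show "C \<in> {C \<in> rect_cells a. plate_scale_saturated C}"
    using assms square_admissible[OF assms]
    by (force simp: rect_cells_def plate_scale_saturated_iff_cube)
qed

theorem proposition8p3:
  fixes a :: real
  assumes "0 < a"
  shows "(\<forall>(l1, l2)\<in>admissible_sides a. mu_parallel l1 l2 \<le> lambda_perp a)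
    \<and> (lambda_perp a \<in> (\<lambda>(l1, l2). mu_parallel l1 l2) ` admissible_sides a
        \<and> (\<forall>m\<in>(\<lambda>(l1, l2). mu_parallel l1 l2) ` admissible_sides a. m \<le> lambda_perp a))
    \<and> (\<forall>l1 l2. is_arg_max (\<lambda>(l1, l2). mu_parallel l1 l2) (\<lambda>p. p \<in> admissible_sides a) (l1, l2)
          \<longleftrightarrow> l1 = a \<and> l2 = a)
    \<and> {C \<in> rect_cells a. plate_scale_saturated C} = {{0..a} \<times> {0..a} \<times> {0..a}}"
proof (intro conjI)
  show "\<forall>(l1, l2)\<in>admissible_sides a. mu_parallel l1 l2 \<le> lambda_perp a"
    using mu_parallel_le_lambda_perp[OF assms] by auto
  show "\<forall>m\<in>(\<lambda>(l1, l2). mu_parallel l1 l2) ` admissible_sides a. m \<le> lambda_perp a"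
    using mu_parallel_le_lambda_perp[OF assms] by auto
  show "lambda_perp a \<in> (\<lambda>(l1, l2). mu_parallel l1 l2) ` admissible_sides a"
    using mu_parallel_eq_lambda_perp_iff[OF assms square_admissible[OF assms]]
      square_admissible[OF assms] by (intro image_eqI[of _ _ "(a, a)"]) auto
  show "\<forall>l1 l2. is_arg_max (\<lambda>(l1, l2). mu_parallel l1 l2) (\<lambda>p. p \<in> admissible_sides a) (l1, l2)
      \<longleftrightarrow> l1 = a \<and> l2 = a"
    using is_arg_max_mu_parallel_iff[OF assms] by blast
  show "{C \<in> rect_cells a. plate_scale_saturated C} = {{0..a} \<times> {0..a} \<times> {0..a}}"
    using saturated_rect_cells[OF assms] by (simp only: rect_cell_def)
qed

end
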